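(* Let $m,n\ge 1$ be integers, let $\mathcal{Y}\subseteq\mathbb{R}^n$, let $h:\mathbb{R}^n\to\mathbb{R}$ and $H^i:\mathbb{R}^n\times\mathbb{R}\to\mathbb{R}$, $i\in[m]$, be functions. For each $i\in[m]$ let $S_i\ge 1$ be an integer, let $d^i_1,\dots,d^i_{S_i}\in\mathbb{R}$ be the realizations of a random variable $\xi^i$, let $q^i\in\mathrm{ri}(\Delta^{S_i})$, and let $\epsilon^i>0$. Put $\mathcal{P}^i(q^i,\epsilon^i)=\{p^i\in\Delta^{S_i}: D_{KL}(p^i\|q^i)\le\epsilon^i\}$. Consider the KL divergence constrained distributionally robust optimization problem $$\text{(P)}\qquad \min_{y\in\mathcal{Y}}\Big\{h(y)+\sum_{i=1}^m\ \max_{p^i\in\mathcal{P}^i(q^i,\epsilon^i)}\ \sum_{s=1}^{S_i}p^i_s\,H^i(y,d^i_s)\Big\}.$$ Then the robust counterpart of (P) is $$\text{(R)}\qquad\begin{aligned}\min\ \ & h(y)+\sum_{i=1}^m\Big[\alpha^i+\epsilon^i\beta^i+\sum_{s=1}^{S_i}q^i_s u^i_s\Big]\\ \text{s.t. }\ & \alpha^i-v^i_s\ge H^i(y,d^i_s), && i\in[m],\ s\in[S_i],\\ & \beta^i+w^i_s=0, && i\in[m],\ s\in[S_i],\\ & \alpha^i\in\mathbb{R},\ \beta^i\in\mathbb{R}_+, && i\in[m],\\ & (u^i_s,v^i_s,w^i_s)\in(K_{\exp})_*, && i\in[m],\ s\in[S_i],\\ & y\in\mathcal{Y}.\end{aligned}$$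 That is, for every $y\in\mathcal{Y}$, the objective value of (P) at $y$ equals the minimum of the objective of (R) over all $(\alpha,\beta,u,v,w)$ such that $(y,\alpha,\beta,u,v,w)$ is feasible for (R).
   Context: Notation: $[k]=\{1,\dots,k\}$; $\mathrm{ri}$ and $\mathrm{cl}$ denote relative interior and closure. The probability simplex is $\Delta^S=\{p\in\mathbb{R}^S_+:\sum_{s=1}^S p_s=1\}$. For $p\in\Delta^S$ and $q\in\mathrm{ri}(\Delta^S)$, the Kullback-Leibler divergence is $D_{KL}(p\|q)=\sum_{s=1}^S p_s\log(p_s/q_s)$, with $0\log 0=0$. In the probabilistic setting, $\Pr(\xi^i=d^i_s)=q^i_s$ is the empirical distribution, and $\sum_s p^i_sH^i(y,d^i_s)$ is the expectation $\mathbb{E}_{\xi^i}[H^i(y,\xi^i)]$ taken under the ambiguous distribution $p^i$ on the realizations $d^i_1,\dots,d^i_{S_i}$. The exponential cone is $K_{\exp}=\mathrm{cl}\{x\in\mathbb{R}^3: x_1\ge x_2e^{x_3/x_2},\ x_2>0\}$. Its dual cone is $(K_{\exp})_*=\{s\in\mathbb{R}^3: x^Ts\ge0\ \ \forall x\in K_{\exp}\}=\mathrm{cl}\{s\in\mathbb{R}^3: s_1\ge -s_3e^{(s_2-s_3)/s_3},\ s_3<0\}$. The robust counterpart of (P) means an equivalent single-level minimization problem obtained by replacing the inner maximizations, in the sense made explicit in the last sentence of the claim. *)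

theory Defs
  imports "HOL-Analysis.Analysis" "HOL-Analysis.Finite_Function_Topology"
begin

text \<open>
  The dimensions $S_1, \dots, S_m$ may differ, so $\mathbb{R}^S$ is taken to be the
  $S$-dimensional subspace of \<^typ>\<open>nat \<Rightarrow>\<^sub>0 real\<close> of the finitely supported functions vanishing
  outside \<open>{1..S}\<close>. This type is a real normed vector space, so that
  \<^const>\<open>rel_interior\<close> applies; affine hulls and the subspace topology are those of $\mathbb{R}^S$.
\<close>

definition prob_simplex :: "nat \<Rightarrow> (nat \<Rightarrow>\<^sub>0 real) set" where
  "prob_simplex S =
    {p. Poly_Mapping.keys p \<subseteq> {1..S} \<and> (\<forall>s\<in>{1..S}. 0 \<le> Poly_Mapping.lookup p s) \<and>
        (\<Sum>s=1..S. Poly_Mapping.lookup p s) = 1}"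

text \<open>
  The convention $0 \log 0 = 0$ holds automatically, as the factor in front of the logarithm is 0.
  The definition is meaningful for \<open>q\<close> with positive coordinates only.
\<close>

definition KL_div :: "nat \<Rightarrow> (nat \<Rightarrow>\<^sub>0 real) \<Rightarrow> (nat \<Rightarrow>\<^sub>0 real) \<Rightarrow> real" where
  "KL_div S p q =
    (\<Sum>s=1..S. Poly_Mapping.lookup p s * ln (Poly_Mapping.lookup p s / Poly_Mapping.lookup q s))"

definition ambiguity_set :: "nat \<Rightarrow> (nat \<Rightarrow>\<^sub>0 real) \<Rightarrow> real \<Rightarrow> (nat \<Rightarrow>\<^sub>0 real) set" where
  "ambiguity_set S q \<epsilon> = {p \<in> prob_simplex S. KL_div S p q \<le> \<epsilon>}"

definition expect :: "nat \<Rightarrow> (nat \<Rightarrow>\<^sub>0 real) \<Rightarrow> (nat \<Rightarrow> real) \<Rightarrow> real" where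
  "expect S p f = (\<Sum>s=1..S. Poly_Mapping.lookup p s * f s)"

definition exp_cone :: "(real ^ 3) set" where
  "exp_cone = closure {x. x $ 1 \<ge> x $ 2 * exp (x $ 3 / x $ 2) \<and> x $ 2 > 0}"

definition dual_cone :: "'a::real_inner set \<Rightarrow> 'a set" where
  "dual_cone K = {s. \<forall>x\<in>K. x \<bullet> s \<ge> 0}"

text \<open>
  The inner maximum over \<^const>\<open>ambiguity_set\<close> is written as a supremum, which is the maximum
  whenever the maximum is attained.
\<close>

definition dro_objective ::
  "nat \<Rightarrow> (nat \<Rightarrow> nat) \<Rightarrow> (nat \<Rightarrow> nat \<Rightarrow>\<^sub>0 real) \<Rightarrow> (nat \<Rightarrow> real) \<Rightarrow> (nat \<Rightarrow> nat \<Rightarrow> real) \<Rightarrow>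
    ('y \<Rightarrow> real) \<Rightarrow> (nat \<Rightarrow> 'y \<Rightarrow> real \<Rightarrow> real) \<Rightarrow> 'y \<Rightarrow> real" where
  "dro_objective m S q \<epsilon> d h H y =
    h y + (\<Sum>i=1..m. SUP p\<in>ambiguity_set (S i) (q i) (\<epsilon> i). expect (S i) p (\<lambda>s. H i y (d i s)))"

definition rc_objective ::
  "nat \<Rightarrow> (nat \<Rightarrow> nat) \<Rightarrow> (nat \<Rightarrow> nat \<Rightarrow>\<^sub>0 real) \<Rightarrow> (nat \<Rightarrow> real) \<Rightarrow> ('y \<Rightarrow> real) \<Rightarrow>
    'y \<Rightarrow> (nat \<Rightarrow> real) \<Rightarrow> (nat \<Rightarrow> real) \<Rightarrow> (nat \<Rightarrow> nat \<Rightarrow> real) \<Rightarrow> real" where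
  "rc_objective m S q \<epsilon> h y \<alpha> \<beta> u =
    h y + (\<Sum>i=1..m. \<alpha> i + \<epsilon> i * \<beta> i + (\<Sum>s=1..S i. Poly_Mapping.lookup (q i) s * u i s))"

definition rc_feasible ::
  "nat \<Rightarrow> (nat \<Rightarrow> nat) \<Rightarrow> (nat \<Rightarrow> nat \<Rightarrow> real) \<Rightarrow> (nat \<Rightarrow> 'y \<Rightarrow> real \<Rightarrow> real) \<Rightarrow> 'y set \<Rightarrow>
    'y \<Rightarrow> (nat \<Rightarrow> real) \<Rightarrow> (nat \<Rightarrow> real) \<Rightarrow>
    (nat \<Rightarrow> nat \<Rightarrow> real) \<Rightarrow> (nat \<Rightarrow> nat \<Rightarrow> real) \<Rightarrow> (nat \<Rightarrow> nat \<Rightarrow> real) \<Rightarrow> bool" where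
  "rc_feasible m S d H Y y \<alpha> \<beta> u v w \<longleftrightarrow>
    (\<forall>i\<in>{1..m}. \<forall>s\<in>{1..S i}. \<alpha> i - v i s \<ge> H i y (d i s)) \<and>
    (\<forall>i\<in>{1..m}. \<forall>s\<in>{1..S i}. \<beta> i + w i s = 0) \<and>
    (\<forall>i\<in>{1..m}. \<beta> i \<ge> 0) \<and>
    (\<forall>i\<in>{1..m}. \<forall>s\<in>{1..S i}. (vector [u i s, v i s, w i s] :: real ^ 3) \<in> dual_cone exp_cone) \<and>
    y \<in> Y"

end

theory Submission
  imports Defs "HOL-Real_Asymp.Real_Asymp"
begin

text \<open>
  The inner problems decouple over \<open>i\<close>. Weak duality pairs \<open>(u\<^sub>s, v\<^sub>s, - \<beta>)\<close> with the point
  \<open>(q\<^sub>s, p\<^sub>s, p\<^sub>s ln (q\<^sub>s / p\<^sub>s))\<close> of the exponential cone. For strong duality both optima are explicit: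
  the divergence from \<open>q\<close> of the exponential tilt \<open>p\<^sub>s \<propto> q\<^sub>s exp (t f\<^sub>s)\<close> is \<open>0\<close> at \<open>t = 0\<close> and tends to
  \<open>- ln q(M)\<close> as \<open>t \<rightarrow> \<infinity>\<close>, where \<open>M\<close> is the set of maximizers of \<open>f\<close>. If \<open>- ln q(M) > \<epsilon>\<close>, some tilt has
  divergence exactly \<open>\<epsilon>\<close> and is optimal, with \<open>\<beta> = 1 / t\<close>. Otherwise \<open>q\<close> conditioned on \<open>M\<close> is
  optimal, with \<open>\<beta> = 0\<close>.
\<close>

section \<open>The dual of the exponential cone\<close>

text \<open>Half-spaces are closed, so a linear inequality valid on the set whose closure is
  \<open>exp_cone\<close> extends to the whole cone.\<close>

lemma dual_cone_exp_cone_iff: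
  "(vector [u, v, w] :: real ^ 3) \<in> dual_cone exp_cone \<longleftrightarrow>
    (\<forall>a b c. 0 < b \<longrightarrow> b * exp (c / b) \<le> a \<longrightarrow> 0 \<le> a * u + b * v + c * w)"
  (is "?L \<longleftrightarrow> ?R")
proof
  assume ?L
  show ?R
  proof (intro allI impI)
    fix a b c :: real
    assume "0 < b" "b * exp (c / b) \<le> a"
    then have "(vector [a, b, c] :: real ^ 3) \<in> exp_cone"
      unfolding exp_cone_def by (intro subsetD[OF closure_subset]) simp
    with \<open>?L\<close> show "0 \<le> a * u + b * v + c * w"
      by (force simp: dual_cone_def inner_vec_def sum_3)
  qed
next
  assume ?R
  then have "{x :: real ^ 3. x $ 1 \<ge> x $ 2 * exp (x $ 3 / x $ 2) \<and> x $ 2 > 0}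
      \<subseteq> {x. vector [u, v, w] \<bullet> x \<ge> 0}"
    by (auto simp: inner_vec_def sum_3 mult.commute[of u] mult.commute[of v] mult.commute[of w])
  then have "exp_cone \<subseteq> {x. vector [u, v, w] \<bullet> x \<ge> 0}"
    unfolding exp_cone_def by (intro closure_minimal closed_halfspace_ge)
  then show ?L
    by (auto simp: dual_cone_def inner_commute)
qed

lemma exp_cone_dual_bound:
  fixes p q :: real
  assumes dual: "vector [u, v, w] \<in> dual_cone exp_cone" and "0 < q" "0 \<le> p"
  shows "0 \<le> q * u + p * v - w * (p * ln (p / q))"
proof (cases "p = 0")
  case True
  \<comment> \<open>The point \<open>(q, 0, 0)\<close> is reached only by closure: the points
    \<open>(q, b, 0)\<close> with \<open>0 < b \<le> q\<close> lie in the generating set, and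
    \<open>b\<close> tends to 0 from the right.\<close>
  have pos: "0 \<le> q * u + b * v" if "0 < b" "b \<le> q" for b
    using dual that unfolding dual_cone_exp_cone_iff by (force dest: spec[of _ q] spec[of _ b] spec[of _ 0])
  have "((\<lambda>b. q * u + b * v) \<longlongrightarrow> q * u + 0 * v) (at_right 0)"
    by (intro tendsto_intros)
  moreover have "\<forall>\<^sub>F b in at_right 0. 0 \<le> q * u + b * v"
    using \<open>0 < q\<close> by (intro eventually_at_rightI[of 0 q] pos) auto
  ultimately show ?thesis
    using True by (auto dest: tendsto_lowerbound)
next
  case False
  with assms have "0 < p" by simp
  with \<open>0 < q\<close> have "p * exp (p * ln (q / p) / p) \<le> q"
    by simp
  with dual \<open>0 < p\<close> have "0 \<le> q * u + p * v + p * ln (q / p) * w"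
    unfolding dual_cone_exp_cone_iff by blast
  moreover have "ln (q / p) = - ln (p / q)"
    using \<open>0 < p\<close> \<open>0 < q\<close> by (simp add: ln_div)
  ultimately show ?thesis
    by (simp add: algebra_simps)
qed

lemma dual_cone_exp_cone_zeroI:
  assumes "0 \<le> v"
  shows "vector [0, v, 0] \<in> dual_cone exp_cone"
  using assms by (simp add: dual_cone_exp_cone_iff)

text \<open>The first coordinate is the boundary value \<open>- w * exp ((v - w) / w)\<close> of the
  dual cone at \<open>w = - \<beta>\<close>. Membership is the inequality
  \<open>1 + x \<le> exp x\<close> at \<open>x = c / b - v / \<beta> - 1\<close>, multiplied by
  \<open>\<beta> * b\<close>.\<close>

lemma dual_cone_exp_coneI:
  assumes "0 < \<beta>"
  shows "vector [\<beta> * exp (- v / \<beta> - 1), v, - \<beta>] \<in> dual_cone exp_cone"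
  unfolding dual_cone_exp_cone_iff
proof (intro allI impI)
  fix a b c :: real
  assume b: "0 < b" and "b * exp (c / b) \<le> a"
  have "0 \<le> \<beta> * b * (exp (c / b - v / \<beta> - 1) - (1 + (c / b - v / \<beta> - 1)))"
    using assms b exp_ge_add_one_self[of "c / b - v / \<beta> - 1"] by (intro mult_nonneg_nonneg) auto
  also have "\<dots> = b * exp (c / b) * (\<beta> * exp (- v / \<beta> - 1)) + b * v - c * \<beta>"
  proof -
    have "exp (c / b - v / \<beta> - 1) = exp (c / b) * exp (- v / \<beta> - 1)"
      by (simp flip: exp_add)
    then show ?thesis
      using assms b by (simp add: field_simps)
  qed
  also have "\<dots> \<le> a * (\<beta> * exp (- v / \<beta> - 1)) + b * v + c * - \<beta>"
    using assms \<open>b * exp (c / b) \<le> a\<close> by (auto intro!: mult_right_mono)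
  finally show "0 \<le> a * (\<beta> * exp (- v / \<beta> - 1)) + b * v + c * - \<beta>" .
qed

section \<open>Weak and strong duality over a finite index set\<close>

text \<open>Weighting the bound on \<open>f s\<close> by \<open>p s\<close> and adding the cone
  inequality with \<open>w = - \<beta>\<close> gives a termwise estimate. Summation leaves \<alpha>
  because the weights total 1, and \<beta> times the divergence, which the bound by \<epsilon>
  controls.\<close>

lemma KL_weak_duality:
  fixes p q f :: "'a \<Rightarrow> real"
  assumes q: "\<And>s. s \<in> A \<Longrightarrow> 0 < q s"
    and p: "\<And>s. s \<in> A \<Longrightarrow> 0 \<le> p s" "sum p A = 1"
    and KL: "(\<Sum>s\<in>A. p s * ln (p s / q s)) \<le> \<epsilon>"
    and "0 \<le> \<beta>"
    and f: "\<And>s. s \<in> A \<Longrightarrow> f s \<le> \<alpha> - v s"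
    and dual: "\<And>s. s \<in> A \<Longrightarrow> vector [u s, v s, - \<beta>] \<in> dual_cone exp_cone"
  shows "(\<Sum>s\<in>A. p s * f s) \<le> \<alpha> + \<epsilon> * \<beta> + (\<Sum>s\<in>A. q s * u s)"
proof -
  have "p s * f s \<le> p s * \<alpha> + \<beta> * (p s * ln (p s / q s)) + q s * u s" if "s \<in> A" for s
    using exp_cone_dual_bound[OF dual q p(1)] mult_left_mono[OF f p(1)] that
    by (fastforce simp: algebra_simps)
  then have "(\<Sum>s\<in>A. p s * f s) \<le> (\<Sum>s\<in>A. p s * \<alpha> + \<beta> * (p s * ln (p s / q s)) + q s * u s)"
    by (rule sum_mono)
  also have "\<dots> = \<alpha> + \<beta> * (\<Sum>s\<in>A. p s * ln (p s / q s)) + (\<Sum>s\<in>A. q s * u s)"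
    by (simp add: sum.distrib p flip: sum_distrib_left sum_distrib_right)
  also have "\<dots> \<le> \<alpha> + \<epsilon> * \<beta> + (\<Sum>s\<in>A. q s * u s)"
    using mult_left_mono[OF KL \<open>0 \<le> \<beta>\<close>] by (simp add: mult.commute)
  finally show ?thesis .
qed

text \<open>A feasible primal point and feasible multipliers with equal values certify each other's
  optimality through weak duality.\<close>

lemma KL_strong_duality:
  fixes q f :: "'a \<Rightarrow> real"
  assumes A: "finite A" "A \<noteq> {}"
    and q: "\<And>s. s \<in> A \<Longrightarrow> 0 < q s" "sum q A = 1"
    and "0 < \<epsilon>"
  obtains p \<beta> \<alpha> v u where
    "\<And>s. s \<in> A \<Longrightarrow> 0 \<le> p s" "sum p A = 1" "(\<Sum>s\<in>A. p s * ln (p s / q s)) \<le> \<epsilon>" "0 \<le> \<beta>"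
    "\<And>s. s \<in> A \<Longrightarrow> f s \<le> \<alpha> - v s"
    "\<And>s. s \<in> A \<Longrightarrow> vector [u s, v s, - \<beta>] \<in> dual_cone exp_cone"
    "(\<Sum>s\<in>A. p s * f s) = \<alpha> + \<epsilon> * \<beta> + (\<Sum>s\<in>A. q s * u s)"
proof -
  define c where "c = Max (f ` A)"
  define M where "M = {s \<in> A. f s = c}"
  define Q where "Q = sum q M"
  have c: "f s \<le> c" if "s \<in> A" for s
    using A that by (simp add: c_def)
  have "c \<in> f ` A"
    unfolding c_def using A by (intro Max_in) auto
  then have M: "M \<noteq> {}" "M \<subseteq> A" "finite M"
    using A by (auto simp: M_def)
  have "0 < Q"
    unfolding Q_def using M q by (intro sum_pos) auto
  show thesis
  proof (cases "- ln Q \<le> \<epsilon>")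
    case True
    define p where "p s = (if f s = c then q s / Q else 0)" for s
    have sum_p: "(\<Sum>s\<in>A. p s * g s) = (\<Sum>s\<in>M. q s * g s) / Q" for g
    proof -
      have "p s * g s = (if s \<in> M then q s * g s / Q else 0)" if "s \<in> A" for s
        using that by (simp add: p_def M_def)
      then have "(\<Sum>s\<in>A. p s * g s) = (\<Sum>s\<in>A. if s \<in> M then q s * g s / Q else 0)"
        by (rule sum.cong[OF refl])
      also have "\<dots> = (\<Sum>s\<in>A \<inter> M. q s * g s / Q)"
        using A by (rule_tac sum.inter_restrict[symmetric])
      finally show ?thesis
        using M by (simp add: Int_absorb1 sum_divide_distrib)
    qed
    have *: "(\<Sum>s\<in>A. p s * ln (p s / q s)) = - ln Q"
    proof -
      have "(\<Sum>s\<in>M. q s * ln (p s / q s)) = (\<Sum>s\<in>M. q s * - ln Q)"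
      proof (rule sum.cong[OF refl])
        fix s assume "s \<in> M"
        with q(1)[of s] \<open>0 < Q\<close> have "p s / q s = inverse Q"
          by (simp add: p_def M_def field_simps)
        with \<open>0 < Q\<close> show "q s * ln (p s / q s) = q s * - ln Q"
          by (simp add: ln_inverse)
      qed
      also have "\<dots> = - ln Q * Q"
        by (simp add: Q_def sum_distrib_right sum_negf mult.commute)
      finally show ?thesis
        using \<open>0 < Q\<close> by (simp add: sum_p)
    qed
    have f: "(\<Sum>s\<in>A. p s * f s) = c"
    proof -
      have "(\<Sum>s\<in>M. q s * f s) = Q * c"
        by (simp add: M_def Q_def sum_distrib_right)
      then show ?thesis
        using \<open>0 < Q\<close> by (simp add: sum_p)
    qed
    have p1: "sum p A = 1"
      using sum_p[of "\<lambda>_. 1"] \<open>0 < Q\<close> by (simp add: Q_def)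
    show thesis
    \<comment> \<open>With \<open>\<beta> = 0\<close> and \<open>u = 0\<close> the dual value is
      \<open>\<alpha> = c\<close>, the mean of \<open>f\<close> under \<open>p\<close>. The slack
      \<open>v = c - f\<close> is nonnegative since \<open>c\<close> is the maximum, so
      \<open>(0, v, 0)\<close> is in the dual cone.\<close>
    proof (rule that[of p 0 c "\<lambda>s. c - f s" "\<lambda>_. 0"])
      show "0 \<le> p s" if "s \<in> A" for s
        using that q(1)[of s] \<open>0 < Q\<close> by (simp add: p_def)
    qed (use True c in \<open>simp_all add: * f p1 dual_cone_exp_cone_zeroI\<close>)
  next
    case False
    \<comment> \<open>Shifting by the maximum leaves the normalized tilt unchanged and makes every
      exponent nonpositive for \<open>t \<ge> 0\<close>, so the limits at infinity exist:
      \<open>exp (t * g s)\<close> tends to 1 on \<open>M\<close> and to 0 off it.\<close>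
    define g where "g s = f s - c" for s
    define Z where "Z t = (\<Sum>s\<in>A. q s * exp (t * g s))" for t
    \<comment> \<open>This is the divergence from \<open>q\<close> of the tilt with parameter
      \<open>t\<close>, as a function to which the intermediate value theorem applies.\<close>
    define K where "K t = (\<Sum>s\<in>A. q s * (t * g s * exp (t * g s))) / Z t - ln (Z t)" for t
    have Z: "0 < Z t" for t
      unfolding Z_def using A q by (intro sum_pos) auto
    have "((\<lambda>t. exp (t * g s)) \<longlongrightarrow> (if s \<in> M then 1 else 0)) at_top"
         "((\<lambda>t. t * g s * exp (t * g s)) \<longlongrightarrow> 0) at_top" if "s \<in> A" for s
    proof -
      have "g s \<le> 0" "s \<in> M \<longleftrightarrow> g s = 0"
        using c that by (auto simp: g_def M_def)
      then consider "s \<in> M" "g s = 0" | "s \<notin> M" "g s < 0"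
        by fastforce
      then show "((\<lambda>t. exp (t * g s)) \<longlongrightarrow> (if s \<in> M then 1 else 0)) at_top"
         "((\<lambda>t. t * g s * exp (t * g s)) \<longlongrightarrow> 0) at_top"
        by (cases; simp; real_asymp)+
    qed
    note lims = this
    have "(Z \<longlongrightarrow> (\<Sum>s\<in>A. q s * (if s \<in> M then 1 else 0))) at_top"
      unfolding Z_def by (intro tendsto_intros lims)
    also have "(\<Sum>s\<in>A. q s * (if s \<in> M then 1 else 0)) = Q"
      unfolding Q_def using A M by (simp add: if_distrib sum.If_cases Int_absorb1 cong: if_cong)
    finally have "(K \<longlongrightarrow> (\<Sum>s\<in>A. q s * 0) / Q - ln Q) at_top"
      unfolding K_def using \<open>0 < Q\<close> by (intro tendsto_intros lims) auto
    with False have "\<forall>\<^sub>F t in at_top. \<epsilon> < K t"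
      by (intro order_tendstoD) auto
    then have "\<forall>\<^sub>F t in at_top. \<epsilon> < K t \<and> 0 \<le> t"
      by (intro eventually_conj eventually_ge_at_top)
    then obtain T where T: "\<epsilon> < K T" "0 \<le> T"
      using eventually_happens'[OF trivial_limit_at_top_linorder] by blast
    have "continuous_on {0..T} Z"
      unfolding Z_def by (intro continuous_intros)
    then have "continuous_on {0..T} K"
      unfolding K_def using Z by (intro continuous_intros) (auto simp: less_imp_neq[THEN not_sym])
    moreover have K0: "K 0 = 0"
      by (simp add: K_def Z_def q)
    ultimately obtain t where t: "0 \<le> t" "K t = \<epsilon>"
      using IVT'[of K 0 \<epsilon> T] T \<open>0 < \<epsilon>\<close> by auto
    with K0 \<open>0 < \<epsilon>\<close> have "0 < t"
      by (cases "t = 0") auto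
    define p where "p s = q s * exp (t * g s) / Z t" for s
    have p_nonneg: "0 \<le> p s" if "s \<in> A" for s
      using q(1)[OF that] Z[of t] by (simp add: p_def)
    have p1: "sum p A = 1"
      using Z[of t] by (simp add: p_def Z_def flip: sum_divide_distrib)
    have "(\<Sum>s\<in>A. p s * ln (p s / q s)) = (\<Sum>s\<in>A. p s * (t * g s - ln (Z t)))"
    proof (rule sum.cong[OF refl])
      fix s assume "s \<in> A"
      with q(1)[of s] have "p s / q s = exp (t * g s) / Z t"
        by (simp add: p_def)
      with Z[of t] show "p s * ln (p s / q s) = p s * (t * g s - ln (Z t))"
        by (simp add: ln_div)
    qed
    also have "\<dots> = t * (\<Sum>s\<in>A. p s * g s) - ln (Z t)"
      by (simp add: algebra_simps sum_subtractf sum_distrib_left p1 flip: sum_distrib_right)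
    finally have KL: "(\<Sum>s\<in>A. p s * ln (p s / q s)) = t * (\<Sum>s\<in>A. p s * g s) - ln (Z t)" .
    have "K t = t * (\<Sum>s\<in>A. p s * g s) - ln (Z t)"
      by (simp add: K_def p_def sum_distrib_left sum_divide_distrib mult_ac)
    with t have eq: "t * (\<Sum>s\<in>A. p s * g s) = \<epsilon> + ln (Z t)"
      by simp
    have "(\<Sum>s\<in>A. p s * f s) = (\<Sum>s\<in>A. p s * g s) + c"
      by (simp add: g_def algebra_simps sum_subtractf p1 flip: sum_distrib_left)
    also have "(\<Sum>s\<in>A. p s * g s) = (\<epsilon> + ln (Z t)) / t"
      using eq \<open>0 < t\<close> by (simp add: field_simps)
    finally have f: "(\<Sum>s\<in>A. p s * f s) = (\<epsilon> + ln (Z t)) / t + c" .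
    \<comment> \<open>Stationarity of the dual value in \<alpha>, with
      \<open>\<beta> = 1 / t\<close> and \<open>v = \<alpha> - f\<close>, requires the
      \<open>q\<close>-weighted sum of \<open>u\<close> to be \<open>1 / t\<close>; this is the
      solution.\<close>
    define \<alpha> where "\<alpha> = c + (ln (Z t) - 1) / t"
    \<comment> \<open>The least \<open>u s\<close> that the dual cone allows for these
      \<open>v\<close> and \<beta>; it equals \<beta> times the density
      \<open>p s / q s\<close>.\<close>
    define u where "u s = 1 / t * exp (- (\<alpha> - f s) / (1 / t) - 1)" for s
    have "u s = exp (t * g s) / Z t / t" for s
    proof -
      have "- (\<alpha> - f s) / (1 / t) - 1 = t * g s - ln (Z t)"
        using \<open>0 < t\<close> by (simp add: \<alpha>_def g_def field_simps)
      then show ?thesis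
        using Z[of t] by (simp add: u_def exp_diff)
    qed
    then have "(\<Sum>s\<in>A. q s * u s) = sum p A / t"
      by (simp add: p_def sum_divide_distrib)
    then have "(\<Sum>s\<in>A. p s * f s) = \<alpha> + \<epsilon> * (1 / t) + (\<Sum>s\<in>A. q s * u s)"
      unfolding f using \<open>0 < t\<close> by (simp add: p1 \<alpha>_def field_simps)
    moreover have "vector [u s, \<alpha> - f s, - (1 / t)] \<in> dual_cone exp_cone" for s
      unfolding u_def using \<open>0 < t\<close> by (intro dual_cone_exp_coneI) simp
    ultimately show thesis
      using p_nonneg p1 \<open>0 < t\<close> eq
      by (intro that[of p "1 / t" \<alpha> "\<lambda>s. \<alpha> - f s" u]) (simp_all add: KL)
  qed
qed

section \<open>Positivity on the relative interior of the simplex\<close>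

lemma lookup_scaleR:
  fixes x :: "'a \<Rightarrow>\<^sub>0 'b::real_vector"
  shows "Poly_Mapping.lookup (r *\<^sub>R x) i = r *\<^sub>R Poly_Mapping.lookup x i"
proof -
  have "finite {i. r *\<^sub>R Poly_Mapping.lookup x i \<noteq> 0}"
    by (rule finite_subset[OF _ finite_keys[of x]]) (auto simp: in_keys_iff)
  then show ?thesis
    by (simp add: scaleR_poly_mapping_def)
qed

lemma rel_interior_prob_simplex_pos:
  assumes q: "q \<in> rel_interior (prob_simplex S)" and s: "s \<in> {1..S}"
  shows "0 < Poly_Mapping.lookup q s"
proof (rule ccontr)
  assume "\<not> 0 < Poly_Mapping.lookup q s"
  have qS: "q \<in> prob_simplex S"
    using q rel_interior_subset by blast
  with \<open>\<not> 0 < _\<close> s have q0: "Poly_Mapping.lookup q s = 0"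
    by (force simp: prob_simplex_def)
  \<comment> \<open>Prolonging the segment from the vertex \<open>?e\<close> to \<open>q\<close> beyond \<open>q\<close> makes coordinate \<open>s\<close> negative.\<close>
  let ?e = "Poly_Mapping.single s (1::real)"
  let ?x = "\<lambda>\<delta>. q + \<delta> *\<^sub>R (q - ?e)"
  have e: "?e \<in> prob_simplex S"
    using s by (auto simp: prob_simplex_def lookup_single when_def)
  \<comment> \<open>A relative neighbourhood of \<open>q\<close> inside the simplex is the affine
    hull cut by an open \<open>U\<close>. The prolonged points stay in the hull, and in
    \<open>U\<close> for small \<delta>.\<close>
  obtain T where T: "openin (top_of_set (affine hull prob_simplex S)) T" "q \<in> T" "T \<subseteq> prob_simplex S"
    using q by (auto simp: rel_interior_def)
  then obtain U where U: "open U" "T = affine hull prob_simplex S \<inter> U"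
    by (auto simp: openin_open)
  have "(?x \<longlongrightarrow> q + 0 *\<^sub>R (q - ?e)) (at_right 0)"
    by (intro tendsto_intros)
  then have "\<forall>\<^sub>F \<delta> in at_right 0. ?x \<delta> \<in> U"
    using U T by (intro topological_tendstoD) auto
  then have "\<forall>\<^sub>F \<delta> in at_right 0. ?x \<delta> \<in> U \<and> 0 < \<delta>"
    by (intro eventually_conj eventually_at_right_less)
  then obtain \<delta> where "0 < \<delta>" "?x \<delta> \<in> U"
    using eventually_happens'[OF trivial_limit_at_right_real] by blast
  moreover have "?x \<delta> \<in> affine hull prob_simplex S"
    using qS e by (intro mem_affine_3_minus affine_affine_hull hull_inc)
  ultimately have "?x \<delta> \<in> prob_simplex S"
    using U T by auto
  then have "0 \<le> Poly_Mapping.lookup (?x \<delta>) s"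
    using s by (simp add: prob_simplex_def)
  also have "\<dots> = - \<delta>"
    by (simp add: q0 lookup_add lookup_minus lookup_scaleR)
  finally show False
    using \<open>0 < \<delta>\<close> by simp
qed

section \<open>Duality for a single ambiguity set\<close>

text \<open>Strong duality yields \<open>p\<close> and the multipliers; weak duality bounds every
  competitor by their common value, so attainment of the inner maximum comes with them.\<close>

lemma ambiguity_set_duality:
  assumes S: "S \<ge> 1" and q: "q \<in> rel_interior (prob_simplex S)" and "0 < \<epsilon>"
  obtains p \<beta> \<alpha> v u where
    "is_arg_max (\<lambda>p. expect S p f) (\<lambda>p. p \<in> ambiguity_set S q \<epsilon>) p" "0 \<le> \<beta>"
    "\<And>s. s \<in> {1..S} \<Longrightarrow> f s \<le> \<alpha> - v s"
    "\<And>s. s \<in> {1..S} \<Longrightarrow> vector [u s, v s, - \<beta>] \<in> dual_cone exp_cone"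
    "expect S p f = \<alpha> + \<epsilon> * \<beta> + (\<Sum>s=1..S. Poly_Mapping.lookup q s * u s)"
proof -
  let ?A = "{1..S}"
  have q_pos: "0 < Poly_Mapping.lookup q s" if "s \<in> ?A" for s
    using q that by (rule rel_interior_prob_simplex_pos)
  have q_sum: "sum (Poly_Mapping.lookup q) ?A = 1"
    using q rel_interior_subset by (fastforce simp: prob_simplex_def)
  have "finite ?A" "?A \<noteq> {}"
    using S by auto
  then obtain p' \<beta> \<alpha> v u where
    p': "\<And>s. s \<in> ?A \<Longrightarrow> 0 \<le> p' s" "sum p' ?A = 1"
      "(\<Sum>s\<in>?A. p' s * ln (p' s / Poly_Mapping.lookup q s)) \<le> \<epsilon>" and
    \<beta>: "0 \<le> \<beta>" and
    fv: "\<And>s. s \<in> ?A \<Longrightarrow> f s \<le> \<alpha> - v s" and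
    dual: "\<And>s. s \<in> ?A \<Longrightarrow> vector [u s, v s, - \<beta>] \<in> dual_cone exp_cone" and
    eq: "(\<Sum>s\<in>?A. p' s * f s) = \<alpha> + \<epsilon> * \<beta> + (\<Sum>s\<in>?A. Poly_Mapping.lookup q s * u s)"
    using KL_strong_duality[OF _ _ q_pos q_sum \<open>0 < \<epsilon>\<close>, where f = f] by blast
  \<comment> \<open>Extension by 0 has finite support, and its keys stay inside
    \<open>{1..S}\<close>.\<close>
  define p where "p = Abs_poly_mapping (\<lambda>s. if s \<in> ?A then p' s else 0)"
  have p: "Poly_Mapping.lookup p = (\<lambda>s. if s \<in> ?A then p' s else 0)"
    unfolding p_def by (rule Abs_poly_mapping_inverse) simp
  have "p \<in> ambiguity_set S q \<epsilon>"
    using p' by (auto simp: ambiguity_set_def prob_simplex_def KL_div_def p in_keys_iff split: if_splits)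
  moreover have p_eq: "expect S p f = \<alpha> + \<epsilon> * \<beta> + (\<Sum>s\<in>?A. Poly_Mapping.lookup q s * u s)"
    unfolding expect_def eq[symmetric] by (simp add: p)
  moreover have "expect S r f \<le> \<alpha> + \<epsilon> * \<beta> + (\<Sum>s\<in>?A. Poly_Mapping.lookup q s * u s)"
    if "r \<in> ambiguity_set S q \<epsilon>" for r
    using that \<beta> fv dual q_pos unfolding expect_def ambiguity_set_def prob_simplex_def KL_div_def
    by (intro KL_weak_duality) auto
  ultimately have "is_arg_max (\<lambda>p. expect S p f) (\<lambda>p. p \<in> ambiguity_set S q \<epsilon>) p"
    by (fastforce simp: is_arg_max_def not_less)
  from this \<beta> fv dual p_eq show thesis
    by (rule that)
qed

text \<open>Turns the supremum in \<open>dro_objective\<close> into an attained value.\<close>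

lemma SUP_eq_arg_max:
  fixes f :: "'a \<Rightarrow> 'b::conditionally_complete_linorder"
  assumes "is_arg_max f (\<lambda>x. x \<in> A) x"
  shows "(SUP x\<in>A. f x) = f x"
  using assms by (intro cSup_eq_maximum) (auto simp: is_arg_max_def not_less)

section \<open>Assembly over the index \<open>i\<close>\<close>

theorem theorem1:
  fixes m :: nat
    and Y :: "(real ^ 'n) set"
    and h :: "real ^ 'n \<Rightarrow> real"
    and H :: "nat \<Rightarrow> real ^ 'n \<Rightarrow> real \<Rightarrow> real"
    and S :: "nat \<Rightarrow> nat"
    and d :: "nat \<Rightarrow> nat \<Rightarrow> real"
    and q :: "nat \<Rightarrow> nat \<Rightarrow>\<^sub>0 real"
    and \<epsilon> :: "nat \<Rightarrow> real"
  assumes "m \<ge> 1"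
    and "\<And>i. i \<in> {1..m} \<Longrightarrow> S i \<ge> 1"
    and "\<And>i. i \<in> {1..m} \<Longrightarrow> q i \<in> rel_interior (prob_simplex (S i))"
    and "\<And>i. i \<in> {1..m} \<Longrightarrow> \<epsilon> i > 0"
  shows "\<forall>y\<in>Y.
    (\<forall>i\<in>{1..m}. \<exists>p. is_arg_max (\<lambda>p. expect (S i) p (\<lambda>s. H i y (d i s)))
                       (\<lambda>p. p \<in> ambiguity_set (S i) (q i) (\<epsilon> i)) p) \<and>
    (\<exists>\<alpha> \<beta> u v w. rc_feasible m S d H Y y \<alpha> \<beta> u v w \<and>
       rc_objective m S q \<epsilon> h y \<alpha> \<beta> u = dro_objective m S q \<epsilon> d h H y) \<and>
    (\<forall>\<alpha> \<beta> u v w. rc_feasible m S d H Y y \<alpha> \<beta> u v w \<longrightarrow>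
       dro_objective m S q \<epsilon> d h H y \<le> rc_objective m S q \<epsilon> h y \<alpha> \<beta> u)"
proof (intro ballI conjI allI impI)
  fix y i assume "i \<in> {1..m}"
  with assms(2-4) show "\<exists>p. is_arg_max (\<lambda>p. expect (S i) p (\<lambda>s. H i y (d i s)))
      (\<lambda>p. p \<in> ambiguity_set (S i) (q i) (\<epsilon> i)) p"
    by (rule_tac ambiguity_set_duality[of "S i" "q i" "\<epsilon> i" "\<lambda>s. H i y (d i s)"]) auto
next
  fix y assume "y \<in> Y"
  have "\<forall>i\<in>{1..m}. \<exists>\<alpha> \<beta> u v.
      (\<forall>s\<in>{1..S i}. H i y (d i s) \<le> \<alpha> - v s) \<and> 0 \<le> \<beta> \<and>
      (\<forall>s\<in>{1..S i}. vector [u s, v s, - \<beta>] \<in> dual_cone exp_cone) \<and>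
      (SUP p\<in>ambiguity_set (S i) (q i) (\<epsilon> i). expect (S i) p (\<lambda>s. H i y (d i s))) =
        \<alpha> + \<epsilon> i * \<beta> + (\<Sum>s=1..S i. Poly_Mapping.lookup (q i) s * u s)"
  proof
    fix i assume i: "i \<in> {1..m}"
    show "\<exists>\<alpha> \<beta> u v.
      (\<forall>s\<in>{1..S i}. H i y (d i s) \<le> \<alpha> - v s) \<and> 0 \<le> \<beta> \<and>
      (\<forall>s\<in>{1..S i}. vector [u s, v s, - \<beta>] \<in> dual_cone exp_cone) \<and>
      (SUP p\<in>ambiguity_set (S i) (q i) (\<epsilon> i). expect (S i) p (\<lambda>s. H i y (d i s))) =
        \<alpha> + \<epsilon> i * \<beta> + (\<Sum>s=1..S i. Poly_Mapping.lookup (q i) s * u s)"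
      by (rule ambiguity_set_duality[OF assms(2-4)[OF i], where f = "\<lambda>s. H i y (d i s)"],
          drule SUP_eq_arg_max, intro exI conjI ballI) auto
  qed
  then obtain \<alpha> \<beta> u v where dual: "\<forall>i\<in>{1..m}.
      (\<forall>s\<in>{1..S i}. H i y (d i s) \<le> \<alpha> i - v i s) \<and> 0 \<le> \<beta> i \<and>
      (\<forall>s\<in>{1..S i}. vector [u i s, v i s, - \<beta> i] \<in> dual_cone exp_cone) \<and>
      (SUP p\<in>ambiguity_set (S i) (q i) (\<epsilon> i). expect (S i) p (\<lambda>s. H i y (d i s))) =
        \<alpha> i + \<epsilon> i * \<beta> i + (\<Sum>s=1..S i. Poly_Mapping.lookup (q i) s * u i s)"
    unfolding bchoice_iff by auto
  \<comment> \<open>The constraint \<open>\<beta> i + w i s = 0\<close> forces this choice of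
    \<open>w\<close>.\<close>
  then have "rc_feasible m S d H Y y \<alpha> \<beta> u v (\<lambda>i _. - \<beta> i)"
    using \<open>y \<in> Y\<close> by (simp add: rc_feasible_def)
  moreover have "rc_objective m S q \<epsilon> h y \<alpha> \<beta> u = dro_objective m S q \<epsilon> d h H y"
    using dual by (simp add: rc_objective_def dro_objective_def)
  ultimately show "\<exists>\<alpha> \<beta> u v w. rc_feasible m S d H Y y \<alpha> \<beta> u v w \<and>
       rc_objective m S q \<epsilon> h y \<alpha> \<beta> u = dro_objective m S q \<epsilon> d h H y"
    by blast
next
  fix y \<alpha> \<beta> u v w
  assume feas: "rc_feasible m S d H Y y \<alpha> \<beta> u v w"
  \<comment> \<open>As the supremum is attained, weak duality at one maximizer suffices; the
    objectives then compare term by term.\<close>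
  have "(SUP p\<in>ambiguity_set (S i) (q i) (\<epsilon> i). expect (S i) p (\<lambda>s. H i y (d i s)))
      \<le> \<alpha> i + \<epsilon> i * \<beta> i + (\<Sum>s=1..S i. Poly_Mapping.lookup (q i) s * u i s)"
    if i: "i \<in> {1..m}" for i
  proof -
    obtain p where max: "is_arg_max (\<lambda>p. expect (S i) p (\<lambda>s. H i y (d i s)))
        (\<lambda>p. p \<in> ambiguity_set (S i) (q i) (\<epsilon> i)) p"
      by (rule ambiguity_set_duality[OF assms(2-4)[OF i]])
    then have p: "p \<in> ambiguity_set (S i) (q i) (\<epsilon> i)"
      by (simp add: is_arg_max_def)
    have w: "w i s = - \<beta> i" if "s \<in> {1..S i}" for s
      using feas i that by (simp add: rc_feasible_def eq_neg_iff_add_eq_0 add.commute)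
    have "expect (S i) p (\<lambda>s. H i y (d i s))
      \<le> \<alpha> i + \<epsilon> i * \<beta> i + (\<Sum>s=1..S i. Poly_Mapping.lookup (q i) s * u i s)"
      unfolding expect_def
    proof (rule KL_weak_duality)
      show "vector [u i s, v i s, - \<beta> i] \<in> dual_cone exp_cone" if "s \<in> {1..S i}" for s
        using feas i that unfolding w[OF that, symmetric] by (simp add: rc_feasible_def)
    qed (use feas i p rel_interior_prob_simplex_pos[OF assms(3)[OF i]] in
        \<open>auto simp: rc_feasible_def ambiguity_set_def prob_simplex_def KL_div_def\<close>)
    then show ?thesis
      by (simp add: SUP_eq_arg_max[OF max])
  qed
  then show "dro_objective m S q \<epsilon> d h H y \<le> rc_objective m S q \<epsilon> h y \<alpha> \<beta> u"
    unfolding dro_objective_def rc_objective_def by (intro add_left_mono sum_mono)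
qed

end
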